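(* (i) There is a normalized monotone subadditive set function $f$ over $[m]$ with $\mathrm{MPH}(f)\ge m/2$. (ii) There is a normalized monotone set function $f$ over $[m]$ with $f\in\mathrm{MPH}\text{-}2$ whose superadditive width and supermodular width are both $m-1$.
   Context: A set function $f:2^{[m]}\to\mathbb{R}$ is normalized if $f(\emptyset)=0$, monotone if $f(S)\le f(T)$ for $S\subseteq T$, subadditive if $f(S\cup T)\le f(S)+f(T)$ for all $S,T$. Write $f(S\mid T)=f(S\cup T)-f(T)$, $f(v\mid T)=f(\{v\}\mid T)$. A set $T$ is supermodular w.r.t. $f$ if there exist $S\subseteq[m]$ and $v\in[m]\setminus T$ with $f(v\mid S\cup T)>\max_{T'\subsetneq T} f(v\mid S\cup T')$; the supermodular width is the maximum cardinality of a nonempty supermodular set (0 if none). A set $T$ is superadditive w.r.t. $f$ if there exists $S\subseteq[m]\setminus T$ with $f(S\mid T)>\max_{T'\subsetneq T} f(S\mid T')$; the superadditive width is the maximum cardinality of a nonempty superadditive set (0 if none). Every normalized $f$ has a unique representation $f(S)=\sum_{T\subseteq S}h(T)$. $\mathrm{PH}\text{-}d$ is the class of $f$ with $h(T)\ge0$ for all $T$ and $h(T)>0$ only if $|T|\le d$. $\mathrm{MPH}\text{-}d$ is the class of functions of the form $f(S)=\max_{i\in[k]}f_i(S)$ with $f_1,\dots,f_k\in\mathrm{PH}\text{-}d$, and $\mathrm{MPH}(f)$ is the least $d$ with $f\in\mathrm{MPH}\text{-}d$. *)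

theory Defs
  imports Complex_Main
begin

text \<open>
  A set function over a finite ground set \<open>V\<close> is a function \<open>f :: 'a set \<Rightarrow> real\<close> of which only the
  values on \<open>Pow V\<close> are meaningful.  Monotonicity is the library's \<open>mono_on (Pow V) f\<close>.
\<close>

definition normalized :: "('a set \<Rightarrow> real) \<Rightarrow> bool" where
  "normalized f \<longleftrightarrow> f {} = 0"

definition subadditive :: "'a set \<Rightarrow> ('a set \<Rightarrow> real) \<Rightarrow> bool" where
  "subadditive V f \<longleftrightarrow> (\<forall>S\<subseteq>V. \<forall>T\<subseteq>V. f (S \<union> T) \<le> f S + f T)"

definition marginal :: "('a set \<Rightarrow> real) \<Rightarrow> 'a set \<Rightarrow> 'a set \<Rightarrow> real" where
  "marginal f S T = f (S \<union> T) - f T"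

text \<open>
  In the next two definitions the maximum ranges over an empty set when \<open>T = {}\<close>; the widths below
  only look at nonempty \<open>T\<close>.
\<close>

definition supermodular_set :: "'a set \<Rightarrow> ('a set \<Rightarrow> real) \<Rightarrow> 'a set \<Rightarrow> bool" where
  "supermodular_set V f T \<longleftrightarrow> T \<subseteq> V \<and>
     (\<exists>S\<subseteq>V. \<exists>v\<in>V - T.
        marginal f {v} (S \<union> T) > Max ((\<lambda>T'. marginal f {v} (S \<union> T')) ` {T'. T' \<subset> T}))"

definition superadditive_set :: "'a set \<Rightarrow> ('a set \<Rightarrow> real) \<Rightarrow> 'a set \<Rightarrow> bool" where
  "superadditive_set V f T \<longleftrightarrow> T \<subseteq> V \<and>
     (\<exists>S\<subseteq>V - T. marginal f S T > Max ((\<lambda>T'. marginal f S T') ` {T'. T' \<subset> T}))"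

definition supermodular_width :: "'a set \<Rightarrow> ('a set \<Rightarrow> real) \<Rightarrow> nat" where
  "supermodular_width V f =
     (if \<exists>T. T \<noteq> {} \<and> supermodular_set V f T
      then Max (card ` {T. T \<noteq> {} \<and> supermodular_set V f T}) else 0)"

definition superadditive_width :: "'a set \<Rightarrow> ('a set \<Rightarrow> real) \<Rightarrow> nat" where
  "superadditive_width V f =
     (if \<exists>T. T \<noteq> {} \<and> superadditive_set V f T
      then Max (card ` {T. T \<noteq> {} \<and> superadditive_set V f T}) else 0)"

definition hypergraph_rep :: "'a set \<Rightarrow> ('a set \<Rightarrow> real) \<Rightarrow> ('a set \<Rightarrow> real) \<Rightarrow> bool" where
  "hypergraph_rep V f h \<longleftrightarrow> (\<forall>S\<subseteq>V. f S = (\<Sum>T\<in>Pow S. h T))"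

lemma hypergraph_rep_exists:
  assumes "finite V"
  shows "\<exists>h. hypergraph_rep V f h"
proof -
  define g where "g S = (\<Sum>T\<in>Pow S. (-1) ^ card T * f T)" for S
  have "f S = (\<Sum>T\<in>Pow S. (-1) ^ card T * g T)" if "S \<subseteq> V" for S
    by (rule inclusion_exclusion_symmetric[OF g_def finite_subset[OF that assms]])
  then show ?thesis
    unfolding hypergraph_rep_def by blast
qed

lemma hypergraph_rep_unique:
  assumes "finite V" "hypergraph_rep V f h" "hypergraph_rep V f h'" "T \<subseteq> V"
  shows "h T = h' T"
proof -
  have "finite T"
    using finite_subset[OF assms(4,1)] .
  then show ?thesis
    using \<open>T \<subseteq> V\<close>
  proof (induction T rule: finite_psubset_induct)
    case (psubset T)
    have split: "(\<Sum>U\<in>Pow T. k U) = k T + (\<Sum>U\<in>Pow T - {T}. k U)" for k :: "'a set \<Rightarrow> real"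
      using psubset.hyps by (intro sum.remove) auto
    have "(\<Sum>U\<in>Pow T - {T}. h U) = (\<Sum>U\<in>Pow T - {T}. h' U)"
      using psubset by (intro sum.cong) auto
    moreover have "(\<Sum>U\<in>Pow T. h U) = (\<Sum>U\<in>Pow T. h' U)"
      using assms(2,3) psubset.prems unfolding hypergraph_rep_def by metis
    ultimately show ?case
      using split[of h] split[of h'] by linarith
  qed
qed

definition PH :: "'a set \<Rightarrow> nat \<Rightarrow> ('a set \<Rightarrow> real) set" where
  "PH V d = {f. normalized f \<and>
     (\<exists>h. hypergraph_rep V f h \<and> (\<forall>T\<subseteq>V. h T \<ge> 0) \<and> (\<forall>T\<subseteq>V. h T > 0 \<longrightarrow> card T \<le> d))}"

definition MPH :: "'a set \<Rightarrow> nat \<Rightarrow> ('a set \<Rightarrow> real) set" where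
  "MPH V d = {f. \<exists>k\<ge>1. \<exists>g. (\<forall>i\<in>{1..k::nat}. g i \<in> PH V d) \<and>
     (\<forall>S\<subseteq>V. f S = Max ((\<lambda>i. g i S) ` {1..k}))}"

definition MPH_level :: "'a set \<Rightarrow> ('a set \<Rightarrow> real) \<Rightarrow> nat" where
  "MPH_level V f = (LEAST d. f \<in> MPH V d)"

text \<open>The least \<open>d\<close> exists for every normalized monotone set function.\<close>

lemma normalized_mono_in_MPH:
  fixes f :: "'a set \<Rightarrow> real"
  assumes V: "finite V" and f0: "normalized f" and mono: "mono_on (Pow V) f"
  shows "f \<in> MPH V (card V)"
proof -
  define F where "F A S = (if A \<subseteq> S then f A else 0)" for A S
  have nonneg: "0 \<le> f A" if "A \<subseteq> V" for A
    using mono_onD[OF mono, of "{}" A] that f0 by (auto simp: normalized_def)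
  have PH: "F A \<in> PH V (card V)" if A: "A \<subseteq> V" for A
  proof -
    define h where "h T = (if T = A then f A else 0)" for T
    have "hypergraph_rep V (F A) h"
      unfolding hypergraph_rep_def
    proof (intro allI impI)
      fix S assume "S \<subseteq> V"
      then have "finite (Pow S)"
        using finite_subset[OF _ V] by simp
      then show "F A S = (\<Sum>T\<in>Pow S. h T)"
        by (simp add: F_def h_def)
    qed
    moreover have "normalized (F A)"
      using f0 by (auto simp: F_def normalized_def)
    moreover have "\<forall>T\<subseteq>V. h T \<ge> 0" "\<forall>T\<subseteq>V. h T > 0 \<longrightarrow> card T \<le> card V"
      using nonneg A V by (auto simp: h_def card_mono)
    ultimately show ?thesis
      unfolding PH_def by blast
  qed
  define k where "k = card (Pow V)"
  obtain b where b: "bij_betw b {1..k} (Pow V)"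
    using ex_bij_betw_nat_finite_1[of "Pow V"] V k_def by auto
  have bV: "b ` {1..k} = Pow V"
    using b by (simp add: bij_betw_def)
  have "1 \<le> k"
    using V by (simp add: k_def card_Pow)
  moreover have "\<forall>i\<in>{1..k}. F (b i) \<in> PH V (card V)"
    using PH bV by blast
  moreover have "f S = Max ((\<lambda>i. F (b i) S) ` {1..k})" if S: "S \<subseteq> V" for S
  proof -
    have "(\<lambda>i. F (b i) S) ` {1..k} = (\<lambda>A. F A S) ` Pow V"
      unfolding bV[symmetric] image_image ..
    moreover have "Max ((\<lambda>A. F A S) ` Pow V) = f S"
    proof (rule Max_eqI)
      show "finite ((\<lambda>A. F A S) ` Pow V)"
        using V by simp
      show "f S \<in> (\<lambda>A. F A S) ` Pow V"
        by (rule image_eqI[of _ _ S]) (use S in \<open>simp_all add: F_def\<close>)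
    next
      fix y assume "y \<in> (\<lambda>A. F A S) ` Pow V"
      then show "y \<le> f S"
        using S nonneg mono_onD[OF mono] by (auto simp: F_def)
    qed
    ultimately show ?thesis
      by simp
  qed
  ultimately show ?thesis
    unfolding MPH_def by (intro CollectI exI[of _ k] conjI exI[of _ "\<lambda>i. F (b i)"]) auto
qed

end

theory Submission
  imports Defs
begin

text \<open>
  (i) In a nonnegative hypergraph representation the marginals \<open>f(v | V - v)\<close> sum to
  \<open>\<Sum>T. |T| h(T)\<close>, which is at most \<open>d f(V)\<close> at level \<open>d\<close>; this bound passes to maxima.  The function
  that is \<open>1\<close> on proper nonempty sets and \<open>2\<close> on \<open>V\<close> is subadditive with all these marginals at
  least \<open>1\<close>, so \<open>m \<le> 2 d\<close>.
  (ii) For the function counting the edges of a star inside a set, the marginal of the centre with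
  respect to \<open>T\<close> is \<open>|T|\<close>, which is strictly increasing; hence the complement of the centre is both
  superadditive and supermodular.
\<close>

section \<open>Marginals at the full ground set as a lower bound on the level\<close>

lemma PH_sum_marginals_le:
  assumes V: "finite V" and f: "f \<in> PH V d"
  shows "(\<Sum>v\<in>V. f V - f (V - {v})) \<le> real d * f V"
proof -
  obtain h where rep: "hypergraph_rep V f h" and nonneg: "\<And>T. T \<subseteq> V \<Longrightarrow> h T \<ge> 0"
    and le: "\<And>T. T \<subseteq> V \<Longrightarrow> h T > 0 \<Longrightarrow> card T \<le> d"
    using f unfolding PH_def by blast
  have fV: "f V = (\<Sum>T\<in>Pow V. h T)"
    using rep by (simp add: hypergraph_rep_def)
  have marg: "f V - f (V - {v}) = (\<Sum>T\<in>Pow V. if v \<in> T then h T else 0)" for v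
  proof -
    have "f (V - {v}) = (\<Sum>T\<in>Pow (V - {v}). h T)"
      using rep by (simp add: hypergraph_rep_def)
    also have "\<dots> = (\<Sum>T\<in>Pow V. if v \<in> T then 0 else h T)"
      by (rule sum.mono_neutral_cong_left) (use V in auto)
    finally have "f V - f (V - {v}) = (\<Sum>T\<in>Pow V. h T - (if v \<in> T then 0 else h T))"
      unfolding fV sum_subtractf by (rule arg_cong)
    also have "\<dots> = (\<Sum>T\<in>Pow V. if v \<in> T then h T else 0)"
      by (rule sum.cong) simp_all
    finally show ?thesis .
  qed
  \<comment> \<open>Double counting: \<open>h T\<close> enters the marginal of each
    \<open>v \<in> T\<close>, hence \<open>card T\<close> times in total.\<close>
  have "(\<Sum>v\<in>V. f V - f (V - {v})) = (\<Sum>T\<in>Pow V. \<Sum>v\<in>V. if v \<in> T then h T else 0)"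
    unfolding marg by (rule sum.swap)
  also have "\<dots> = (\<Sum>T\<in>Pow V. real (card T) * h T)"
  proof (rule sum.cong[OF refl])
    fix T assume "T \<in> Pow V"
    then have "V \<inter> T = T" by auto
    then show "(\<Sum>v\<in>V. if v \<in> T then h T else 0) = real (card T) * h T"
      using sum.inter_restrict[OF V, of "\<lambda>_. h T" T] by simp
  qed
  also have "\<dots> \<le> (\<Sum>T\<in>Pow V. real d * h T)"
  proof (rule sum_mono)
    fix T assume "T \<in> Pow V"
    then show "real (card T) * h T \<le> real d * h T"
      \<comment> \<open>The bound \<open>card T \<le> d\<close> is known only where
        \<open>h T > 0\<close>; where \<open>h T = 0\<close>, both sides vanish whatever the size of
        \<open>T\<close>.\<close>
      using nonneg[of T] le[of T] by (cases "h T = 0") (auto intro: mult_right_mono)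
  qed
  finally show ?thesis
    unfolding fV by (simp add: sum_distrib_left)
qed

text \<open>Take a component attaining the maximum at \<open>V\<close>. It agrees with
  \<open>f\<close> there and is at most \<open>f\<close> on each \<open>V - {v}\<close>, so its
  marginals dominate those of \<open>f\<close>.\<close>

lemma MPH_sum_marginals_le:
  assumes V: "finite V" and f: "f \<in> MPH V d"
  shows "(\<Sum>v\<in>V. f V - f (V - {v})) \<le> real d * f V"
proof -
  obtain k :: nat and g where k: "k \<ge> 1" and g: "\<And>i. i \<in> {1..k} \<Longrightarrow> g i \<in> PH V d"
    and f_max: "\<And>S. S \<subseteq> V \<Longrightarrow> f S = Max ((\<lambda>i. g i S) ` {1..k})"
    using f unfolding MPH_def by blast
  have "f V \<in> (\<lambda>i. g i V) ` {1..k}"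
    using f_max[of V] k Max_in[of "(\<lambda>i. g i V) ` {1..k}"] by auto
  then obtain i where i: "i \<in> {1..k}" and eq: "f V = g i V"
    by blast
  have "g i (V - {v}) \<le> f (V - {v})" for v
    using f_max[of "V - {v}"] i by auto
  then have "(\<Sum>v\<in>V. f V - f (V - {v})) \<le> (\<Sum>v\<in>V. g i V - g i (V - {v}))"
    unfolding eq by (intro sum_mono diff_left_mono)
  also have "\<dots> \<le> real d * f V"
    unfolding eq using PH_sum_marginals_le[OF V g[OF i]] .
  finally show ?thesis .
qed

text \<open>A least level is attained as soon as some level works, and \<open>card V\<close>
  does.\<close>

lemma in_MPH_MPH_level:
  assumes "finite V" "normalized f" "mono_on (Pow V) f"
  shows "f \<in> MPH V (MPH_level V f)"
  unfolding MPH_level_def by (rule LeastI) (rule normalized_mono_in_MPH[OF assms])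

lemma PH_subset_MPH: "PH V d \<subseteq> MPH V d"
proof
  fix f assume "f \<in> PH V d"
  then show "f \<in> MPH V d"
    unfolding MPH_def by (intro CollectI exI[of _ "1::nat"] conjI exI[of _ "\<lambda>_. f"]) auto
qed

section \<open>A subadditive function of high level\<close>

definition step_fun :: "'a set \<Rightarrow> 'a set \<Rightarrow> real" where
  "step_fun V S = (if S = {} then 0 else if S = V then 2 else 1)"

lemma normalized_step_fun: "normalized (step_fun V)"
  by (simp add: normalized_def step_fun_def)

lemma mono_on_step_fun: "mono_on (Pow V) (step_fun V)"
proof (rule mono_onI)
  fix S T :: "'a set" assume "S \<in> Pow V" "T \<in> Pow V" "S \<subseteq> T"
  then have "T = {} \<Longrightarrow> S = {}" "S = V \<Longrightarrow> T = V"
    by blast+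
  then show "step_fun V S \<le> step_fun V T"
    by (cases "S = {}"; cases "T = {}"; cases "S = V") (simp_all add: step_fun_def)
qed

text \<open>No value exceeds 2 and nonempty sets have value at least 1, so two nonempty sets always
  suffice; an empty one leaves the union unchanged.\<close>

lemma subadditive_step_fun: "subadditive V (step_fun V)"
  unfolding subadditive_def
proof (intro allI impI)
  fix S T
  show "step_fun V (S \<union> T) \<le> step_fun V S + step_fun V T"
    by (cases "S = {}"; cases "T = {}") (simp_all add: step_fun_def)
qed

lemma MPH_level_step_fun:
  assumes V: "finite V" "V \<noteq> {}"
  shows "real (card V) / 2 \<le> real (MPH_level V (step_fun V))"
proof -
  let ?d = "MPH_level V (step_fun V)"
  have "real (card V) = (\<Sum>v\<in>V. 1)"
    by simp
  also have "\<dots> \<le> (\<Sum>v\<in>V. step_fun V V - step_fun V (V - {v}))"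
    \<comment> \<open>Each marginal is \<open>2 - 1\<close>, except that it is \<open>2 - 0\<close>
      when \<open>V\<close> is a singleton.\<close>
    by (rule sum_mono) (auto simp: step_fun_def)
  also have "\<dots> \<le> real ?d * step_fun V V"
    by (intro MPH_sum_marginals_le in_MPH_MPH_level V normalized_step_fun mono_on_step_fun)
  finally show ?thesis
    using V by (simp add: step_fun_def)
qed

section \<open>The star function\<close>

definition star_edges :: "'a \<Rightarrow> 'a set \<Rightarrow> real" where
  "star_edges c S = (if c \<in> S then real (card (S - {c})) else 0)"

lemma normalized_star_edges: "normalized (star_edges c)"
  by (simp add: normalized_def star_edges_def)

lemma mono_on_star_edges: "finite V \<Longrightarrow> mono_on (Pow V) (star_edges c)"
proof (rule mono_onI)
  fix S T assume "finite V" "S \<in> Pow V" "T \<in> Pow V" "S \<subseteq> T"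
  then have "finite (T - {c})" "S - {c} \<subseteq> T - {c}"
    using finite_subset by blast+
  then have "card (S - {c}) \<le> card (T - {c})"
    by (rule card_mono)
  then show "star_edges c S \<le> star_edges c T"
    using \<open>S \<subseteq> T\<close> by (auto simp: star_edges_def simp del: card_Diff_insert card_Diff_singleton)
qed

lemma star_edges_in_PH:
  assumes V: "finite V"
  shows "star_edges c \<in> PH V 2"
proof -
  define E where "E = (\<lambda>u. {c, u}) ` (V - {c})"
  define h :: "'a set \<Rightarrow> real" where "h T = (if T \<in> E then 1 else 0)" for T
  have "hypergraph_rep V (star_edges c) h"
    unfolding hypergraph_rep_def
  proof (intro allI impI)
    fix S assume S: "S \<subseteq> V"
    then have fin: "finite (Pow S)"
      using finite_subset[OF _ V] by simp
    have "(\<Sum>T\<in>Pow S. h T) = real (card (Pow S \<inter> E))"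
      unfolding h_def using sum.inter_restrict[OF fin, of "\<lambda>_. 1::real" E] by simp
    \<comment> \<open>An edge inside \<open>S\<close> requires the centre in \<open>S\<close> and is
      then determined by its leaf, so counting edges amounts to counting leaves.\<close>
    also have "Pow S \<inter> E = (if c \<in> S then (\<lambda>u. {c, u}) ` (S - {c}) else {})"
      using S by (auto simp: E_def)
    also have "real (card \<dots>) = star_edges c S"
      by (auto simp: star_edges_def card_image inj_on_def doubleton_eq_iff)
    finally show "star_edges c S = (\<Sum>T\<in>Pow S. h T)" by simp
  qed
  moreover have "\<forall>T\<subseteq>V. h T \<ge> 0" "\<forall>T\<subseteq>V. h T > 0 \<longrightarrow> card T \<le> 2"
    by (auto simp: h_def E_def card_insert_if)
  ultimately show ?thesis
    using normalized_star_edges unfolding PH_def by (intro CollectI conjI exI[of _ h])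
qed

lemma marginal_star_edges:
  assumes "c \<notin> T"
  shows "marginal (star_edges c) {c} T = real (card T)"
  using assms by (simp add: marginal_def star_edges_def)

lemma marginal_star_edges_gt_Max:
  assumes T: "finite T" "T \<noteq> {}" "c \<notin> T"
  shows "Max ((\<lambda>T'. marginal (star_edges c) {c} T') ` {T'. T' \<subset> T})
    < marginal (star_edges c) {c} T"
proof -
  have fin: "finite {T'. T' \<subset> T}"
    by (rule finite_subset[of _ "Pow T"]) (use T in auto)
  have "marginal (star_edges c) {c} T' < marginal (star_edges c) {c} T" if "T' \<subset> T" for T'
  proof -
    have "c \<notin> T'" using that T by blast
    then show ?thesis
      using psubset_card_mono[OF T(1) that] T(3) by (simp add: marginal_star_edges)
  qed
  \<comment> \<open>This makes the range of the maximum nonempty, so that bounding every element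
    strictly bounds \<open>Max\<close> strictly.\<close>
  moreover have "{} \<subset> T" using T by blast
  ultimately show ?thesis
    using fin by (subst Max_less_iff) auto
qed

section \<open>The two widths of the star function\<close>

lemma not_superadditive_set_ground_set:
  assumes V: "finite V" "V \<noteq> {}"
  shows "\<not> superadditive_set V f V"
proof
  assume "superadditive_set V f V"
  then have "Max ((\<lambda>T'. marginal f {} T') ` {T'. T' \<subset> V}) < marginal f {} V"
    by (auto simp: superadditive_set_def)
  \<comment> \<open>Only \<open>{}\<close> is disjoint from the whole ground set, and all its
    marginals are 0, which rules out a strict increase.\<close>
  moreover have "(\<lambda>T'. marginal f {} T') ` {T'. T' \<subset> V} = {0}"
    using V by (auto simp: marginal_def)
  ultimately show False
    by (simp add: marginal_def)
qed

lemma not_supermodular_set_ground_set: "\<not> supermodular_set V f V"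
  by (auto simp: supermodular_set_def)

text \<open>Serves both widths, with \<open>P\<close> the respective property: excluding
  \<open>V\<close> bounds the cardinality by \<open>card V - 1\<close>, and \<open>V - {c}\<close>
  attains the bound.\<close>

lemma width_eq_card_minus_1:
  assumes V: "finite V"
    and proper: "\<And>T. P T \<Longrightarrow> T \<subset> V"
    and c: "c \<in> V" and witness: "V - {c} \<noteq> {} \<Longrightarrow> P (V - {c})"
  shows "(if \<exists>T. T \<noteq> {} \<and> P T then Max (card ` {T. T \<noteq> {} \<and> P T}) else 0) = card V - 1"
proof (cases "V - {c} = {}")
  \<comment> \<open>With one element the candidate \<open>V - {c}\<close> is empty, and the default
    width 0 coincides with \<open>card V - 1\<close>.\<close>
  case True
  then have "V = {c}" using c by blast
  then have "\<not> (\<exists>T. T \<noteq> {} \<and> P T)"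
    using proper by blast
  then have "?thesis \<longleftrightarrow> 0 = card V - 1"
    by (subst if_not_P) auto
  then show ?thesis
    using \<open>V = {c}\<close> by simp
next
  case False
  have "Max (card ` {T. T \<noteq> {} \<and> P T}) = card V - 1"
  proof (rule Max_eqI)
    have "{T. T \<noteq> {} \<and> P T} \<subseteq> Pow V"
      using proper by blast
    then show "finite (card ` {T. T \<noteq> {} \<and> P T})"
      using V finite_subset by blast
    show "card V - 1 \<in> card ` {T. T \<noteq> {} \<and> P T}"
      by (rule image_eqI[of _ _ "V - {c}"]) (use False witness c in auto)
  next
    fix n assume "n \<in> card ` {T. T \<noteq> {} \<and> P T}"
    then obtain T where "P T" "n = card T" by blast
    then show "n \<le> card V - 1"
      using psubset_card_mono[OF V proper, of T] by linarith
  qed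
  moreover have "\<exists>T. T \<noteq> {} \<and> P T"
    by (intro exI[of _ "V - {c}"] conjI False witness)
  ultimately show ?thesis
    by (subst if_P)
qed

lemma superadditive_width_star_edges:
  assumes V: "finite V" and c: "c \<in> V"
  shows "superadditive_width V (star_edges c) = card V - 1"
  unfolding superadditive_width_def
proof (rule width_eq_card_minus_1[OF V _ c])
  fix T assume "superadditive_set V (star_edges c) T"
  then show "T \<subset> V"
    using not_superadditive_set_ground_set[OF V, of "star_edges c"] c
    by (cases "T = V") (auto simp: superadditive_set_def)
next
  assume "V - {c} \<noteq> {}"
  then show "superadditive_set V (star_edges c) (V - {c})"
    unfolding superadditive_set_def
    \<comment> \<open>The added set is the centre alone.\<close>
    using marginal_star_edges_gt_Max[of "V - {c}" c] V c by (intro conjI exI[of _ "{c}"]) auto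
qed

lemma supermodular_width_star_edges:
  assumes V: "finite V" and c: "c \<in> V"
  shows "supermodular_width V (star_edges c) = card V - 1"
  unfolding supermodular_width_def
proof (rule width_eq_card_minus_1[OF V _ c])
  fix T assume "supermodular_set V (star_edges c) T"
  then show "T \<subset> V"
    using not_supermodular_set_ground_set[of V] by (auto simp: supermodular_set_def)
next
  assume "V - {c} \<noteq> {}"
  then show "supermodular_set V (star_edges c) (V - {c})"
    unfolding supermodular_set_def
    \<comment> \<open>Empty context \<open>S = {}\<close> and \<open>v = c\<close> reduce the
      condition to the same inequality as for superadditivity.\<close>
    using marginal_star_edges_gt_Max[of "V - {c}" c] V c
    by (intro conjI exI[of _ "{}"] bexI[of _ c]) auto
qed

theorem theorem7:
  fixes m :: nat
  assumes "m \<ge> 1"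
  shows "(\<exists>f :: nat set \<Rightarrow> real.
            normalized f \<and> mono_on (Pow {1..m}) f \<and> subadditive {1..m} f \<and>
            real (MPH_level {1..m} f) \<ge> real m / 2) \<and>
         (\<exists>f :: nat set \<Rightarrow> real.
            normalized f \<and> mono_on (Pow {1..m}) f \<and> f \<in> MPH {1..m} 2 \<and>
            superadditive_width {1..m} f = m - 1 \<and>
            supermodular_width {1..m} f = m - 1)"
proof (rule conjI)
  let ?V = "{1..m}"
  have V: "finite ?V" "?V \<noteq> {}" "1 \<in> ?V"
    using assms by auto
  have "real m / 2 \<le> real (MPH_level ?V (step_fun ?V))"
    using MPH_level_step_fun[OF V(1,2)] by simp
  then show "\<exists>f. normalized f \<and> mono_on (Pow ?V) f \<and> subadditive ?V f \<and>
      real (MPH_level ?V f) \<ge> real m / 2"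
    using normalized_step_fun mono_on_step_fun subadditive_step_fun
    by (intro exI[of _ "step_fun ?V"] conjI)
  have "superadditive_width ?V (star_edges 1) = m - 1" "supermodular_width ?V (star_edges 1) = m - 1"
    using superadditive_width_star_edges[OF V(1,3)] supermodular_width_star_edges[OF V(1,3)]
    by simp_all
  moreover have "star_edges 1 \<in> MPH ?V 2"
    using star_edges_in_PH[OF V(1)] PH_subset_MPH by blast
  ultimately show "\<exists>f. normalized f \<and> mono_on (Pow ?V) f \<and> f \<in> MPH ?V 2 \<and>
      superadditive_width ?V f = m - 1 \<and> supermodular_width ?V f = m - 1"
    using normalized_star_edges mono_on_star_edges[OF V(1)]
    by (intro exI[of _ "star_edges 1"] conjI)
qed

end
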